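(* An element $g$ of $\mathrm{Diffeo}^+(\mathbb{R})$ is reversible in $\mathrm{Diffeo}^+(\mathbb{R})$ if and only if it is conjugate in $\mathrm{Diffeo}^+(\mathbb{R})$ to a map $f \in \mathrm{Diffeo}^+(\mathbb{R})$ that fixes each integer and satisfies $f(x+1) = f^{-1}(x)+1$ for all $x\in\mathbb{R}$.
   Context: A diffeomorphism of $\mathbb{R}$ is an infinitely differentiable homeomorphism of $\mathbb{R}$ onto itself whose derivative never vanishes. $\mathrm{Diffeo}^+(\mathbb{R})$ is the group, under composition, of all order preserving (strictly increasing) diffeomorphisms of $\mathbb{R}$. An element $f$ of a group $G$ is reversible in $G$ if there is $h\in G$ with $hfh^{-1}=f^{-1}$. *)

theory Defs
  imports "HOL-Analysis.Analysis" "HOL-Algebra.Group"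
begin

definition smooth :: "(real \<Rightarrow> real) \<Rightarrow> bool"
  where "smooth f \<longleftrightarrow> (\<forall>n x. (deriv ^^ n) f field_differentiable at x)"

(* The library notation inv_into UNIV f is used for the inverse function, since the symbol inv
   is also the inverse of HOL-Algebra groups. *)
definition diffeomorphism :: "(real \<Rightarrow> real) \<Rightarrow> bool"
  where "diffeomorphism f \<longleftrightarrow>
    homeomorphism UNIV UNIV f (inv_into UNIV f) \<and> smooth f \<and> (\<forall>x. deriv f x \<noteq> 0)"

definition Diffeo_plus :: "(real \<Rightarrow> real) monoid"
  where "Diffeo_plus =
    \<lparr>carrier = {f. diffeomorphism f \<and> strict_mono f}, mult = (\<circ>), one = id\<rparr>"

definition reversible_in :: "('a, 'b) monoid_scheme \<Rightarrow> 'a \<Rightarrow> bool"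
  where "reversible_in G f \<longleftrightarrow>
    (\<exists>h \<in> carrier G. h \<otimes>\<^bsub>G\<^esub> f \<otimes>\<^bsub>G\<^esub> inv\<^bsub>G\<^esub> h = inv\<^bsub>G\<^esub> f)"

definition conjugate_in :: "('a, 'b) monoid_scheme \<Rightarrow> 'a \<Rightarrow> 'a \<Rightarrow> bool"
  where "conjugate_in G g f \<longleftrightarrow>
    (\<exists>h \<in> carrier G. h \<otimes>\<^bsub>G\<^esub> g \<otimes>\<^bsub>G\<^esub> inv\<^bsub>G\<^esub> h = f)"

end

theory Submission
  imports Defs
begin

text \<open>Suppose \<open>h g h\<^sup>-\<^sup>1 = g\<^sup>-\<^sup>1\<close>. Then \<open>g\<close> commutes with \<open>h\<^sup>2\<close> and has a fixed point between \<open>x\<close> and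
  \<open>h x\<close> for every \<open>x\<close> that it moves. If \<open>h\<close> has a fixed point, each component of the complement of
  its fixed point set has a finite end, and Kopell's lemma forces \<open>g = id\<close>. Otherwise \<open>h\<close> (or \<open>h\<^sup>-\<^sup>1\<close>)
  moves all points to the right, so a smooth solution \<open>H\<close> of Abel's equation \<open>H \<circ> h = H + 1\<close> conjugates
  it to the translation by \<open>1\<close>; normalising \<open>H\<close> to vanish at a fixed point of \<open>g\<close>, the conjugate of
  \<open>g\<close> by \<open>H\<close> is the required map. Conversely the translation by \<open>-1\<close> reverses such a map.\<close>

subsection \<open>Smooth functions\<close>

text \<open>The derivative is taken at the inner end, so induction on \<open>n\<close> with
  \<open>f\<close> arbitrary passes from \<open>f\<close> to \<open>deriv f\<close>. Closure rules
  are proved at finite order, since the derivative of a product, composite or reciprocal is built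
  from such terms of one order less.\<close>

primrec ndiff :: "nat \<Rightarrow> (real \<Rightarrow> real) \<Rightarrow> bool" where
  "ndiff 0 f \<longleftrightarrow> True"
| "ndiff (Suc n) f \<longleftrightarrow> (\<forall>x. f field_differentiable at x) \<and> ndiff n (deriv f)"

lemma ndiff_iff: "ndiff n f \<longleftrightarrow> (\<forall>i<n. \<forall>x. (deriv ^^ i) f field_differentiable at x)"
proof (induction n arbitrary: f)
  case (Suc n)
  show ?case
    by (auto simp: Suc.IH less_Suc_eq_0_disj funpow_swap1)
qed simp

lemma smooth_iff_ndiff: "smooth f \<longleftrightarrow> (\<forall>n. ndiff n f)"
  by (auto simp: smooth_def ndiff_iff)

lemma ndiff_SucI:
  assumes "\<And>x. (f has_field_derivative f' x) (at x)" "ndiff n f'"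
  shows "ndiff (Suc n) f"
proof -
  have "deriv f = f'"
    using assms(1) by (auto intro: DERIV_imp_deriv)
  with assms show ?thesis
    by (auto simp: field_differentiable_def)
qed

lemma ndiff_has_derivative: "ndiff (Suc n) f \<Longrightarrow> (f has_field_derivative deriv f x) (at x)"
  by (auto simp: DERIV_deriv_iff_field_differentiable)

lemma ndiff_lower: "ndiff (Suc n) f \<Longrightarrow> ndiff n f"
  by (auto simp: ndiff_iff)

lemma ndiff_const [simp]: "ndiff n (\<lambda>x. c)"
proof (induction n arbitrary: c)
  case (Suc n)
  show ?case
    by (rule ndiff_SucI[where f' = "\<lambda>x. 0"]) (use Suc in auto)
qed simp

lemma ndiff_add: "ndiff n f \<Longrightarrow> ndiff n g \<Longrightarrow> ndiff n (\<lambda>x. f x + g x)"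
proof (induction n arbitrary: f g)
  case (Suc n)
  show ?case
    by (rule ndiff_SucI[where f' = "\<lambda>x. deriv f x + deriv g x"])
       (use Suc in \<open>auto intro!: DERIV_add simp: DERIV_deriv_iff_field_differentiable\<close>)
qed simp

lemma ndiff_mult: "ndiff n f \<Longrightarrow> ndiff n g \<Longrightarrow> ndiff n (\<lambda>x. f x * g x)"
proof (induction n arbitrary: f g)
  case (Suc n)
  have "((\<lambda>x. f x * g x) has_field_derivative deriv f x * g x + deriv g x * f x) (at x)" for x
    by (rule DERIV_mult[OF ndiff_has_derivative ndiff_has_derivative]) (rule Suc.prems)+
  moreover have "ndiff n (\<lambda>x. deriv f x * g x + deriv g x * f x)"
    using Suc.prems Suc.prems[THEN ndiff_lower] by (intro ndiff_add Suc.IH) simp_all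
  ultimately show ?case
    by (rule ndiff_SucI)
qed simp

lemma ndiff_compose: "ndiff n f \<Longrightarrow> ndiff n g \<Longrightarrow> ndiff n (\<lambda>x. f (g x))"
proof (induction n arbitrary: f g)
  case (Suc n)
  have "((\<lambda>x. f (g x)) has_field_derivative deriv f (g x) * deriv g x) (at x)" for x
    by (rule DERIV_chain2[OF ndiff_has_derivative ndiff_has_derivative]) (rule Suc.prems)+
  moreover have "ndiff n (\<lambda>x. deriv f (g x) * deriv g x)"
    using Suc.prems Suc.prems(2)[THEN ndiff_lower]
    by (intro ndiff_mult Suc.IH[of "deriv f" g]) simp_all
  ultimately show ?case
    by (rule ndiff_SucI)
qed simp

text \<open>The derivative is written as a product with \<open>inverse (f x)\<close> among its
  factors, so that the induction hypothesis covers it.\<close>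

lemma ndiff_inverse:
  assumes "ndiff n f" "\<And>x. f x \<noteq> 0"
  shows "ndiff n (\<lambda>x. inverse (f x))"
  using assms(1)
proof (induction n)
  case (Suc n)
  have "((\<lambda>x. inverse (f x)) has_field_derivative
      - 1 * (inverse (f x) * (deriv f x * inverse (f x)))) (at x)" for x
    using DERIV_inverse'[OF ndiff_has_derivative[OF Suc.prems, of x] assms(2)]
    by (simp add: mult.assoc)
  moreover have "ndiff n (\<lambda>x. - 1 * (inverse (f x) * (deriv f x * inverse (f x))))"
    using Suc.prems ndiff_lower[OF Suc.prems] by (intro ndiff_mult Suc.IH ndiff_const) simp_all
  ultimately show ?case
    by (rule ndiff_SucI)
qed simp

section \<open>Closure properties and locality of smoothness\<close>

lemma smooth_has_derivative: "smooth f \<Longrightarrow> (f has_field_derivative deriv f x) (at x)"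
  by (rule ndiff_has_derivative[of 0]) (simp only: smooth_iff_ndiff)

lemma smooth_isCont: "smooth f \<Longrightarrow> isCont f x"
  by (rule DERIV_isCont[OF smooth_has_derivative])

lemma smooth_deriv: "smooth f \<Longrightarrow> smooth (deriv f)"
  by (metis comp_apply funpow_Suc_right smooth_def)

lemma smooth_derivI:
  assumes "\<And>x. (f has_field_derivative f' x) (at x)" "smooth f'"
  shows "smooth f"
  unfolding smooth_iff_ndiff
proof
  fix n
  have "ndiff (Suc n) f"
    using assms by (intro ndiff_SucI[of f f']) (simp_all add: smooth_iff_ndiff)
  then show "ndiff n f" by (rule ndiff_lower)
qed

lemma smooth_const: "smooth (\<lambda>x. c)"
  by (simp add: smooth_iff_ndiff)

lemma smooth_add: "smooth f \<Longrightarrow> smooth g \<Longrightarrow> smooth (\<lambda>x. f x + g x)"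
  using ndiff_add[of _ f g] by (simp add: smooth_iff_ndiff)

lemma smooth_mult: "smooth f \<Longrightarrow> smooth g \<Longrightarrow> smooth (\<lambda>x. f x * g x)"
  using ndiff_mult[of _ f g] by (simp add: smooth_iff_ndiff)

lemma smooth_compose: "smooth f \<Longrightarrow> smooth g \<Longrightarrow> smooth (\<lambda>x. f (g x))"
  using ndiff_compose[of _ f g] by (simp add: smooth_iff_ndiff)

lemma smooth_inverse: "smooth f \<Longrightarrow> (\<And>x. f x \<noteq> 0) \<Longrightarrow> smooth (\<lambda>x. inverse (f x))"
  using ndiff_inverse[of _ f] by (simp add: smooth_iff_ndiff)

lemma smooth_ident: "smooth (\<lambda>x. x)"
  by (rule smooth_derivI[OF DERIV_ident smooth_const])

lemma smooth_affine: "smooth (\<lambda>x. a * x + b)"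
  by (intro smooth_add smooth_mult smooth_const smooth_ident)

lemma smooth_sum: "(\<And>i. i \<in> I \<Longrightarrow> smooth (f i)) \<Longrightarrow> smooth (\<lambda>x. \<Sum>i\<in>I. f i x)"
  by (induction I rule: infinite_finite_induct) (auto intro: smooth_const smooth_add)

text \<open>Agreement on a neighbourhood passes to all derivatives. This gives smoothness of a
  locally finite series later.\<close>

lemma smooth_local:
  assumes "\<And>x. \<exists>g. smooth g \<and> (\<forall>\<^sub>F y in nhds x. f y = g y)"
  shows "smooth f"
proof -
  have higher: "\<forall>\<^sub>F y in nhds x. (deriv ^^ n) f y = (deriv ^^ n) g y"
    if "\<forall>\<^sub>F y in nhds x. f y = g y" for g x n
  proof (induction n)
    case (Suc n)
    \<comment> \<open>Agreement near \<open>x\<close> entails agreement near each \<open>y\<close>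
      close to \<open>x\<close>, hence equal next derivatives at those \<open>y\<close>.\<close>
    from Suc show ?case
      by (subst (asm) eventually_eventually[symmetric]) (auto elim!: eventually_mono intro: deriv_cong_ev)
  qed (use that in simp)
  show ?thesis
    unfolding smooth_def
  proof (intro allI)
    fix n x
    from assms[of x] obtain g where g: "smooth g" "\<forall>\<^sub>F y in nhds x. f y = g y" by blast
    have "((deriv ^^ n) g has_field_derivative deriv ((deriv ^^ n) g) x) (at x)"
      using g(1) by (auto simp: smooth_def DERIV_deriv_iff_field_differentiable)
    then have "((deriv ^^ n) f has_field_derivative deriv ((deriv ^^ n) g) x) (at x)"
      using DERIV_cong_ev[OF refl higher[OF g(2)] refl] by blast
    then show "(deriv ^^ n) f field_differentiable at x"
      by (auto simp: field_differentiable_def)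
  qed
qed

section \<open>A flat function and smooth steps\<close>

definition flat :: "nat \<Rightarrow> real \<Rightarrow> real"
  where "flat n x = (if x > 0 then inverse x ^ n * exp (- inverse x) else 0)"

text \<open>On the right, \<open>y = inverse x\<close> reduces this to the decay of
  \<open>y ^ n * exp (- y)\<close> at infinity.\<close>

lemma flat_tendsto_0: "(flat n \<longlongrightarrow> 0) (at 0)"
proof -
  have "((\<lambda>x. inverse x ^ n * exp (- inverse x)) \<longlongrightarrow> 0) (at_right (0::real))"
  proof (rule filterlim_compose[OF _ filterlim_inverse_at_top_right])
    show "((\<lambda>y. y ^ n * exp (- y)) \<longlongrightarrow> (0::real)) at_top"
      using tendsto_power_div_exp_0[of n] by (simp add: exp_minus field_simps)
  qed
  then have "(flat n \<longlongrightarrow> 0) (at_right 0)"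
    by (rule Lim_transform_eventually) (auto simp: flat_def eventually_at_filter)
  moreover have "(flat n \<longlongrightarrow> 0) (at_left 0)"
    by (rule Lim_transform_eventually[OF tendsto_const]) (auto simp: flat_def eventually_at_filter)
  ultimately show ?thesis
    by (simp add: filterlim_at_split)
qed

text \<open>The powers of \<open>inverse x\<close> make the family closed under differentiation up
  to linear combinations, so smoothness follows by induction on the order, for all \<open>n\<close>
  at once.\<close>

lemma flat_has_derivative:
  "(flat n has_field_derivative (- real n * flat (Suc n) x + flat (Suc (Suc n)) x)) (at x)"
proof -
  consider "x < 0" | "x = 0" | "x > 0" by linarith
  then show ?thesis
  proof cases
    case 1
    have "((\<lambda>x. 0) has_field_derivative 0) (at x)" by simp
    then have "(flat n has_field_derivative 0) (at x)"
      by (rule has_field_derivative_transform_within_open[of _ _ _ "{..<0}"]) (use 1 in \<open>auto simp: flat_def\<close>)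
    with 1 show ?thesis by (simp add: flat_def)
  next
    case 2
    \<comment> \<open>The difference quotient of \<open>flat n\<close> at \<open>0\<close> is
      \<open>flat (Suc n)\<close>.\<close>
    have "(flat n has_field_derivative 0) (at 0)"
      unfolding DERIV_def
      by (rule Lim_transform_eventually[OF flat_tendsto_0[of "Suc n"]])
         (auto simp: flat_def eventually_at_filter field_simps)
    with 2 show ?thesis by (simp add: flat_def)
  next
    case 3
    have "((\<lambda>x. inverse x ^ n * exp (- inverse x)) has_field_derivative
        (- real n * flat (Suc n) x + flat (Suc (Suc n)) x)) (at x)"
    proof (rule DERIV_cong)
      show "((\<lambda>x. inverse x ^ n * exp (- inverse x)) has_field_derivative
          (real n * inverse x ^ (n - 1) * - (inverse x ^ 2) * exp (- inverse x) +
           inverse x ^ n * (exp (- inverse x) * inverse x ^ 2))) (at x)"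
        using 3 by (auto intro!: derivative_eq_intros simp: power2_eq_square)
    qed (use 3 in \<open>cases n; simp add: flat_def power2_eq_square algebra_simps\<close>)
    then show ?thesis
      by (rule has_field_derivative_transform_within_open[of _ _ _ "{0<..}"]) (use 3 in \<open>auto simp: flat_def\<close>)
  qed
qed

lemma smooth_flat: "smooth (flat n)"
proof -
  have "ndiff k (flat n)" for k
  proof (induction k arbitrary: n)
    case (Suc k)
    show ?case
      by (rule ndiff_SucI[OF flat_has_derivative]) (intro ndiff_add ndiff_mult ndiff_const Suc)
  qed simp
  then show ?thesis by (simp add: smooth_iff_ndiff)
qed

text \<open>The step is \<open>u / (u + v)\<close>, with \<open>u\<close> vanishing up to
  \<open>a\<close> and \<open>v\<close> from \<open>b\<close> on; since \<open>a < b\<close> they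
  never vanish together. As \<open>u\<close> increases and \<open>v\<close> decreases, the numerator
  of the derivative is a sum of nonnegative terms, positive strictly between \<open>a\<close> and
  \<open>b\<close>.\<close>

lemma smooth_step_exists:
  fixes a b :: real
  assumes "a < b"
  obtains R where "smooth R" "\<And>x. x \<le> a \<Longrightarrow> R x = 0" "\<And>x. x \<ge> b \<Longrightarrow> R x = 1"
    "\<And>x. deriv R x \<ge> 0" "\<And>x. a < x \<Longrightarrow> x < b \<Longrightarrow> deriv R x > 0"
proof -
  define u where "u x = flat 0 (x - a)" for x
  define v where "v x = flat 0 (b - x)" for x
  define R where "R x = u x * inverse (u x + v x)" for x
  have su: "smooth u"
    using smooth_compose[OF smooth_flat[of 0] smooth_affine[of 1 "-a"]] by (simp add: u_def[abs_def])
  have sv: "smooth v"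
    using smooth_compose[OF smooth_flat[of 0] smooth_affine[of "-1" b]] by (simp add: v_def[abs_def])
  have uv: "u x + v x > 0" for x
    using assms by (auto simp: u_def v_def flat_def intro: add_pos_pos)
  have sR: "smooth R"
    unfolding R_def[abs_def] using uv
    by (intro smooth_mult smooth_inverse smooth_add su sv) (metis less_irrefl)
  \<comment> \<open>At index \<open>0\<close> the first term of the derivative formula drops out,
    leaving \<open>flat 2\<close>.\<close>
  have du: "(u has_field_derivative flat 2 (x - a)) (at x)" for x
    unfolding u_def[abs_def]
    by (rule DERIV_cong[OF DERIV_chain2[OF flat_has_derivative]])
       (auto intro!: derivative_eq_intros simp: numeral_2_eq_2)
  have dv: "(v has_field_derivative - flat 2 (b - x)) (at x)" for x
    unfolding v_def[abs_def]
    by (rule DERIV_cong[OF DERIV_chain2[OF flat_has_derivative]])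
       (auto intro!: derivative_eq_intros simp: numeral_2_eq_2)
  have uvne: "u x + v x \<noteq> 0" for x using uv[of x] by simp
  have "(R has_field_derivative
      (flat 2 (x - a) * v x + u x * flat 2 (b - x)) * inverse (u x + v x) ^ 2) (at x)" for x
    unfolding R_def[abs_def]
  proof (rule DERIV_cong[OF DERIV_mult[OF du DERIV_inverse'[OF DERIV_add[OF du dv] uvne]]])
    let ?i = "inverse (u x + v x)" and ?p = "flat 2 (x - a)" and ?q = "flat 2 (b - x)"
    \<comment> \<open>This brings the first summand over the squared denominator, where the terms
      \<open>?p * u x\<close> cancel.\<close>
    have "?p * ?i = ?p * ?i * ((u x + v x) * ?i)"
      using uvne[of x] by simp
    then show "?p * ?i + - (?i * (?p + - ?q) * ?i) * u x = (?p * v x + u x * ?q) * ?i ^ 2"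
      by (simp add: algebra_simps power2_eq_square)
  qed
  then have dR: "deriv R x = (flat 2 (x - a) * v x + u x * flat 2 (b - x)) * inverse (u x + v x) ^ 2" for x
    by (rule DERIV_imp_deriv)
  have nn: "flat n x \<ge> 0" for n x by (simp add: flat_def)
  have pos: "flat n x > 0" if "x > 0" for n x using that by (simp add: flat_def)
  show thesis
  proof
    show "smooth R" by (rule sR)
    show "R x = 0" if "x \<le> a" for x using that by (simp add: R_def u_def flat_def)
    show "R x = 1" if "x \<ge> b" for x using that uvne[of x] by (simp add: R_def v_def flat_def)
    show "deriv R x \<ge> 0" for x
      unfolding dR u_def v_def by (intro mult_nonneg_nonneg add_nonneg_nonneg nn) simp
    show "deriv R x > 0" if "a < x" "x < b" for x
      unfolding dR using that uv[of x]
      by (intro mult_pos_pos add_pos_pos zero_less_power) (auto simp: u_def v_def pos)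
  qed
qed

subsection \<open>The diffeomorphism group\<close>

lemma smooth_deriv_pos_strict_mono:
  assumes "smooth f" "\<And>x. deriv f x > 0"
  shows "strict_mono f"
  using DERIV_pos_imp_increasing smooth_has_derivative[OF assms(1)] assms(2)
  by (metis strict_monoI)

lemma strict_mono_deriv_nonneg:
  fixes f :: "real \<Rightarrow> real"
  assumes "strict_mono f" "(f has_field_derivative D) (at x)"
  shows "D \<ge> 0"
proof (rule ccontr)
  assume "\<not> D \<ge> 0"
  then obtain d where "d > 0" and d: "\<And>h. h > 0 \<Longrightarrow> h < d \<Longrightarrow> f x > f (x + h)"
    using DERIV_neg_dec_right[OF assms(2)] by auto
  from d[of "d / 2"] \<open>d > 0\<close> strict_monoD[OF assms(1), of x "x + d / 2"] show False
    by simp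
qed

lemma strict_mono_inv_isCont:
  fixes f :: "real \<Rightarrow> real"
  assumes "\<And>x. isCont f x" "strict_mono f" "surj f"
  shows "isCont (inv_into UNIV f) y"
proof -
  obtain x where y: "y = f x" using \<open>surj f\<close> by (metis surjD)
  show ?thesis
    unfolding y
    by (rule isCont_inverse_function2[of "x - 1" x "x + 1"])
       (use assms in \<open>auto simp: inv_f_f strict_mono_imp_inj_on\<close>)
qed

lemma inv_has_derivative:
  assumes "smooth f" "\<And>x. deriv f x > 0" "surj f"
  shows "(inv_into UNIV f has_field_derivative inverse (deriv f (inv_into UNIV f y))) (at y)"
proof (rule DERIV_inverse_function[where f = f and a = "y - 1" and b = "y + 1"])
  show "(f has_field_derivative deriv f (inv_into UNIV f y)) (at (inv_into UNIV f y))"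
    by (rule smooth_has_derivative[OF assms(1)])
  show "deriv f (inv_into UNIV f y) \<noteq> 0"
    using assms(2)[of "inv_into UNIV f y"] by simp
  show "isCont (inv_into UNIV f) y"
    using assms smooth_isCont smooth_deriv_pos_strict_mono strict_mono_inv_isCont by blast
qed (use assms in \<open>auto simp: surj_f_inv_f\<close>)

text \<open>Bootstrapping: the derivative of the inverse is the reciprocal of \<open>deriv f\<close>
  composed with the inverse, so each order of differentiability yields the next.\<close>

lemma smooth_inv:
  assumes "smooth f" "\<And>x. deriv f x > 0" "surj f"
  shows "smooth (inv_into UNIV f)"
proof -
  have "ndiff n (inv_into UNIV f)" for n
  proof (induction n)
    case (Suc n)
    have "ndiff n (deriv f)"
      using smooth_deriv[OF assms(1)] by (simp add: smooth_iff_ndiff)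
    then have "ndiff n (\<lambda>y. inverse (deriv f (inv_into UNIV f y)))"
      by (intro ndiff_inverse[OF ndiff_compose[OF _ Suc]]) (use assms(2) in \<open>auto simp: less_imp_neq[symmetric]\<close>)
    then show ?case
      by (rule ndiff_SucI[OF inv_has_derivative[OF assms]])
  qed simp
  then show ?thesis by (simp add: smooth_iff_ndiff)
qed

text \<open>A monotone function has nonnegative derivative, hence a positive one where it does not
  vanish. Conversely a continuous strictly increasing surjection has a continuous inverse.
  Membership is checked in this form below.\<close>

lemma carrier_Diffeo_plus_iff:
  "f \<in> carrier Diffeo_plus \<longleftrightarrow> smooth f \<and> (\<forall>x. deriv f x > 0) \<and> surj f"
proof
  assume f: "f \<in> carrier Diffeo_plus"
  then have "smooth f" "strict_mono f" "surj f" and ne: "\<And>x. deriv f x \<noteq> 0"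
    by (auto simp: Diffeo_plus_def diffeomorphism_def homeomorphism_def)
  then show "smooth f \<and> (\<forall>x. deriv f x > 0) \<and> surj f"
    using strict_mono_deriv_nonneg[OF \<open>strict_mono f\<close> smooth_has_derivative[OF \<open>smooth f\<close>]]
    by (auto simp: less_le ne[symmetric])
next
  assume f: "smooth f \<and> (\<forall>x. deriv f x > 0) \<and> surj f"
  then have sm: "strict_mono f" by (auto intro: smooth_deriv_pos_strict_mono)
  then have "inj f" by (rule strict_mono_imp_inj_on)
  have "isCont (inv_into UNIV f) y" for y
    using f sm by (auto intro: strict_mono_inv_isCont smooth_isCont)
  then have "homeomorphism UNIV UNIV f (inv_into UNIV f)"
    using f \<open>inj f\<close> smooth_isCont by (auto simp: homeomorphism_def surj_f_inv_f inj_imp_surj_inv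
      intro!: continuous_at_imp_continuous_on)
  with f sm show "f \<in> carrier Diffeo_plus"
    by (simp add: Diffeo_plus_def diffeomorphism_def less_imp_neq[symmetric])
qed

text \<open>Cited by position below: 1 to 6 are regularity, 7 to 9 compare values, 10 and 11 cancel
  the inverse.\<close>

lemma Diffeo_plusD:
  assumes "f \<in> carrier Diffeo_plus"
  shows "smooth f" "deriv f x > 0" "surj f" "strict_mono f" "inj f" "isCont f x"
    "f x < f y \<longleftrightarrow> x < y" "f x \<le> f y \<longleftrightarrow> x \<le> y" "f x = f y \<longleftrightarrow> x = y"
    "f (inv_into UNIV f x) = x" "inv_into UNIV f (f x) = x"
proof -
  show *: "smooth f" "deriv f x > 0" "surj f" "isCont f x" and sm: "strict_mono f"
    using assms by (auto simp: carrier_Diffeo_plus_iff smooth_isCont intro: smooth_deriv_pos_strict_mono)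
  then show "inj f" by (auto intro: strict_mono_imp_inj_on)
  then show "f x < f y \<longleftrightarrow> x < y" "f x \<le> f y \<longleftrightarrow> x \<le> y" "f x = f y \<longleftrightarrow> x = y"
    "f (inv_into UNIV f x) = x" "inv_into UNIV f (f x) = x"
    using sm * by (auto simp: strict_mono_less strict_mono_less_eq strict_mono_eq surj_f_inv_f)
qed

lemma Diffeo_plus_compose:
  assumes f: "f \<in> carrier Diffeo_plus" and g: "g \<in> carrier Diffeo_plus"
  shows "f \<circ> g \<in> carrier Diffeo_plus"
  unfolding carrier_Diffeo_plus_iff
proof (intro conjI allI)
  show "smooth (f \<circ> g)"
    using smooth_compose[OF Diffeo_plusD(1)[OF f] Diffeo_plusD(1)[OF g]] by (simp add: comp_def)
  show "surj (f \<circ> g)"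
    using Diffeo_plusD(3)[OF f] Diffeo_plusD(3)[OF g] by (rule comp_surj[rotated])
  fix x
  have "((f \<circ> g) has_field_derivative deriv f (g x) * deriv g x) (at x)"
    by (intro DERIV_chain smooth_has_derivative Diffeo_plusD f g)
  then have "deriv (f \<circ> g) x = deriv f (g x) * deriv g x"
    by (rule DERIV_imp_deriv)
  then show "deriv (f \<circ> g) x > 0"
    using Diffeo_plusD(2)[OF f] Diffeo_plusD(2)[OF g] by simp
qed

lemma Diffeo_plus_affine:
  assumes "a > 0"
  shows "(\<lambda>x. a * x + b) \<in> carrier Diffeo_plus"
proof -
  have "((\<lambda>x. a * x + b) has_field_derivative a) (at x)" for x
    by (auto intro!: derivative_eq_intros)
  then have "deriv (\<lambda>x. a * x + b) x = a" for x
    by (rule DERIV_imp_deriv)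
  moreover have "surj (\<lambda>x. a * x + b)"
    by (rule surjI[of _ "\<lambda>y. (y - b) / a"]) (use assms in simp)
  ultimately show ?thesis
    using assms by (simp add: carrier_Diffeo_plus_iff smooth_affine)
qed

lemma Diffeo_plus_id: "id \<in> carrier Diffeo_plus"
  using Diffeo_plus_affine[of 1 0] by (simp add: id_def)

lemma Diffeo_plus_inv:
  assumes f: "f \<in> carrier Diffeo_plus"
  shows "inv_into UNIV f \<in> carrier Diffeo_plus"
proof -
  note D = Diffeo_plusD[OF f]
  have "deriv (inv_into UNIV f) x = inverse (deriv f (inv_into UNIV f x))" for x
    by (rule DERIV_imp_deriv[OF inv_has_derivative]) (fact D)+
  moreover have "smooth (inv_into UNIV f)"
    by (rule smooth_inv) (fact D)+
  ultimately show ?thesis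
    using D by (auto simp: carrier_Diffeo_plus_iff inj_imp_surj_inv)
qed

lemma Diffeo_plus_funpow: "f \<in> carrier Diffeo_plus \<Longrightarrow> f ^^ n \<in> carrier Diffeo_plus"
  by (induction n) (auto intro: Diffeo_plus_compose Diffeo_plus_id)

lemma mult_Diffeo_plus: "f \<otimes>\<^bsub>Diffeo_plus\<^esub> g = f \<circ> g"
  and one_Diffeo_plus: "\<one>\<^bsub>Diffeo_plus\<^esub> = id"
  by (simp_all add: Diffeo_plus_def)

lemma group_Diffeo_plus: "group Diffeo_plus"
proof (rule groupI)
  fix f assume "f \<in> carrier Diffeo_plus"
  then show "\<exists>g\<in>carrier Diffeo_plus. g \<otimes>\<^bsub>Diffeo_plus\<^esub> f = \<one>\<^bsub>Diffeo_plus\<^esub>"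
    by (intro bexI[of _ "inv_into UNIV f"]) (auto simp: mult_Diffeo_plus one_Diffeo_plus Diffeo_plus_inv Diffeo_plusD)
qed (auto simp: mult_Diffeo_plus one_Diffeo_plus Diffeo_plus_id Diffeo_plus_compose comp_assoc)

lemma m_inv_Diffeo_plus:
  assumes "f \<in> carrier Diffeo_plus"
  shows "inv\<^bsub>Diffeo_plus\<^esub> f = inv_into UNIV f"
  using assms
  by (intro group.inv_equality[OF group_Diffeo_plus])
     (auto simp: mult_Diffeo_plus one_Diffeo_plus Diffeo_plus_inv Diffeo_plusD)

subsection \<open>Kopell's lemma\<close>

lemma funpow_limit_fixed:
  fixes f :: "real \<Rightarrow> real"
  assumes "isCont f l" "(\<lambda>n. (f ^^ n) x) \<longlonglongrightarrow> l"
  shows "f l = l"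
proof -
  have "(\<lambda>n. f ((f ^^ n) x)) \<longlonglongrightarrow> f l"
    using assms by (rule isCont_tendsto_compose)
  moreover have "(\<lambda>n. f ((f ^^ n) x)) \<longlonglongrightarrow> l"
    using LIMSEQ_Suc[OF assms(2)] by simp
  ultimately show ?thesis by (rule LIMSEQ_unique)
qed

lemma funpow_fixed: "f x = x \<Longrightarrow> (f ^^ n) x = x"
  by (induction n) auto

lemma funpow_commute: "(\<And>x. g (f x) = f (g x)) \<Longrightarrow> g ((f ^^ n) x) = (f ^^ n) (g x)"
  by (induction n) auto

text \<open>The orbit is monotone, in the direction of its first step, and the fixed ends confine
  it.\<close>

lemma funpow_tendsto_fixed:
  fixes f :: "real \<Rightarrow> real"
  assumes cont: "\<And>x. isCont f x" and "mono f" and ab: "f a = a" "f b = b" and x: "a \<le> x" "x \<le> b"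
  obtains l where "(\<lambda>n. (f ^^ n) x) \<longlonglongrightarrow> l" "a \<le> l" "l \<le> b" "f l = l"
proof -
  have bounds: "a \<le> (f ^^ n) x" "(f ^^ n) x \<le> b" for n
    using monoD[OF mono_pow[OF \<open>mono f\<close>, of n] x(1)] monoD[OF mono_pow[OF \<open>mono f\<close>, of n] x(2)]
    by (simp_all add: funpow_fixed ab)
  have step: "(f ^^ n) (f x) = (f ^^ Suc n) x" for n
    by (simp add: funpow_swap1)
  have "monoseq (\<lambda>n. (f ^^ n) x)"
  proof (cases "x \<le> f x")
    case True
    then have "(f ^^ n) x \<le> (f ^^ Suc n) x" for n
      using monoD[OF mono_pow[OF \<open>mono f\<close>, of n] True] by (simp only: step)
    then show ?thesis by (simp add: monoseq_Suc)
  next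
    case False
    then have "(f ^^ Suc n) x \<le> (f ^^ n) x" for n
      using monoD[OF mono_pow[OF \<open>mono f\<close>, of n], of "f x" x] by (simp only: step)
    then show ?thesis by (simp add: monoseq_Suc)
  qed
  moreover have "Bseq (\<lambda>n. (f ^^ n) x)"
    using bounds by (intro BseqI'[of _ "max \<bar>a\<bar> \<bar>b\<bar>"]) (smt (verit) real_norm_def)
  ultimately obtain l where l: "(\<lambda>n. (f ^^ n) x) \<longlonglongrightarrow> l"
    using Bseq_monoseq_convergent convergentD by blast
  moreover have "a \<le> l" "l \<le> b"
    using bounds by (auto intro: LIMSEQ_le_const[OF l] LIMSEQ_le_const2[OF l])
  ultimately show thesis
    using that funpow_limit_fixed[OF cont l] by blast
qed

text \<open>The orbit decreases to a fixed point in \<open>[a, p]\<close>, and \<open>less\<close>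
  leaves only \<open>a\<close>.\<close>

lemma contraction_tendsto:
  fixes f :: "real \<Rightarrow> real"
  assumes cont: "\<And>x. isCont f x" and "mono f" and "f a = a"
    and less: "\<And>t. a < t \<Longrightarrow> t \<le> p \<Longrightarrow> f t < t" and x: "a \<le> x" "x \<le> p"
  shows "(\<lambda>n. (f ^^ n) x) \<longlonglongrightarrow> a"
proof -
  have bounds: "a \<le> (f ^^ n) x \<and> (f ^^ n) x \<le> p" for n
  proof (induction n)
    case (Suc n)
    then show ?case
      using monoD[OF \<open>mono f\<close>, of a "(f ^^ n) x"] less[of "(f ^^ n) x"] \<open>f a = a\<close> by fastforce
  qed (use x in simp)
  have "decseq (\<lambda>n. (f ^^ n) x)"
    using bounds less \<open>f a = a\<close> by (intro decseq_SucI) (metis comp_apply funpow.simps(2) le_less)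
  then obtain l where l: "(\<lambda>n. (f ^^ n) x) \<longlonglongrightarrow> l"
    using decseq_convergent[of _ a] bounds by blast
  have "a \<le> l" "l \<le> p"
    using bounds by (auto intro: LIMSEQ_le_const[OF l] LIMSEQ_le_const2[OF l])
  with funpow_limit_fixed[OF cont l] less[of l] have "l = a" by fastforce
  with l show ?thesis by simp
qed

section \<open>Bounded distortion of iterates\<close>

lemma funpow_has_derivative:
  assumes "smooth f"
  shows "((f ^^ n) has_field_derivative (\<Prod>i<n. deriv f ((f ^^ i) x))) (at x)"
proof (induction n)
  case (Suc n)
  show ?case
    using DERIV_chain[OF smooth_has_derivative[OF assms] Suc] by (simp add: comp_def mult.commute)
qed (simp add: id_def)

text \<open>Bounded distortion: the intervals \<open>\<phi>\<^sup>i [\<phi> p, p]\<close> do not overlap, so their lengths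
  add up to at most \<open>p - a\<close>, and \<open>ln \<circ> \<phi>'\<close> is Lipschitz on \<open>[a, p]\<close>.\<close>

lemma funpow_distortion:
  assumes \<phi>: "\<phi> \<in> carrier Diffeo_plus" and "\<phi> a = a" and "a < p"
    and less: "\<And>t. a < t \<Longrightarrow> t \<le> p \<Longrightarrow> \<phi> t < t"
  obtains K where "\<And>n u v. u \<in> {\<phi> p..p} \<Longrightarrow> v \<in> {\<phi> p..p} \<Longrightarrow>
    deriv (\<phi> ^^ n) u \<le> K * deriv (\<phi> ^^ n) v"
proof -
  note D = Diffeo_plusD[OF \<phi>]
  define L where "L x = ln (deriv \<phi> x)" for x
  have L: "(L has_field_derivative deriv (deriv \<phi>) x / deriv \<phi> x) (at x)" for x
    unfolding L_def[abs_def] using D(2)[of x] smooth_has_derivative[OF smooth_deriv[OF D(1)], of x]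
    by (auto intro!: derivative_eq_intros)
  have "continuous_on {a..p} (\<lambda>x. deriv (deriv \<phi>) x / deriv \<phi> x)"
    using D(1,2) by (intro continuous_at_imp_continuous_on ballI isCont_divide smooth_isCont smooth_deriv)
      (auto simp: less_imp_neq[symmetric])
  then have "bounded ((\<lambda>x. deriv (deriv \<phi>) x / deriv \<phi> x) ` {a..p})"
    by (intro compact_imp_bounded compact_continuous_image compact_Icc)
  then obtain C where C: "\<And>x. x \<in> {a..p} \<Longrightarrow> norm (deriv (deriv \<phi>) x / deriv \<phi> x) \<le> C"
    unfolding bounded_iff by blast
  have "C \<ge> 0"
    using C[of a] \<open>a < p\<close> by (smt (verit) atLeastAtMost_iff norm_ge_zero)
  have Lip: "\<bar>L x - L y\<bar> \<le> C * \<bar>x - y\<bar>" if "x \<in> {a..p}" "y \<in> {a..p}" for x y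
    using field_differentiable_bound[of "{a..p}" L "\<lambda>x. deriv (deriv \<phi>) x / deriv \<phi> x" C x y]
      C that L by (auto intro: has_field_derivative_at_within)
  have mono_n: "(\<phi> ^^ n) x \<le> (\<phi> ^^ n) y" if "x \<le> y" for n x y
    using that Diffeo_plusD(8)[OF Diffeo_plus_funpow[OF \<phi>]] by blast
  have in_ap: "(\<phi> ^^ n) x \<in> {a..p}" if "x \<in> {a..p}" for n x
  proof (induction n)
    case (Suc n)
    then show ?case
      using D(8)[of a "(\<phi> ^^ n) x"] less[of "(\<phi> ^^ n) x"] \<open>\<phi> a = a\<close> by fastforce
  qed (use that in simp)
  have pa: "a \<le> \<phi> p" "\<phi> p \<le> p"
    using in_ap[of p 1] \<open>a < p\<close> by auto
  \<comment> \<open>By the chain rule the logarithm of the derivative is a sum along the orbit, so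
    ratios of derivatives become differences of sums.\<close>
  have deriv_eq: "deriv (\<phi> ^^ n) u = exp (\<Sum>i<n. L ((\<phi> ^^ i) u))" for n u
    using DERIV_imp_deriv[OF funpow_has_derivative[OF D(1)], of n u] D(2)
    by (simp add: exp_sum L_def)
  show thesis
  proof
    fix n u v assume uv: "u \<in> {\<phi> p..p}" "v \<in> {\<phi> p..p}"
    have "(\<Sum>i<n. L ((\<phi> ^^ i) u)) - (\<Sum>i<n. L ((\<phi> ^^ i) v)) =
        (\<Sum>i<n. L ((\<phi> ^^ i) u) - L ((\<phi> ^^ i) v))"
      by (simp add: sum_subtractf)
    also have "\<dots> \<le> (\<Sum>i<n. C * ((\<phi> ^^ i) p - (\<phi> ^^ Suc i) p))"
    proof (rule sum_mono)
      fix i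
      have "L ((\<phi> ^^ i) u) - L ((\<phi> ^^ i) v) \<le> C * \<bar>(\<phi> ^^ i) u - (\<phi> ^^ i) v\<bar>"
        using Lip[OF in_ap[of u i] in_ap[of v i]] uv pa by auto
      \<comment> \<open>Both points lie in the \<open>i\<close>-th image of
        \<open>[\<phi> p, p]\<close>, and the lengths of these images telescope.\<close>
      also have "\<bar>(\<phi> ^^ i) u - (\<phi> ^^ i) v\<bar> \<le> (\<phi> ^^ i) p - (\<phi> ^^ i) (\<phi> p)"
        using uv mono_n[of u p i] mono_n[of v p i] mono_n[of "\<phi> p" u i] mono_n[of "\<phi> p" v i] by auto
      finally show "L ((\<phi> ^^ i) u) - L ((\<phi> ^^ i) v) \<le> C * ((\<phi> ^^ i) p - (\<phi> ^^ Suc i) p)"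
        using \<open>C \<ge> 0\<close> by (simp add: mult_left_mono funpow_swap1)
    qed
    also have "\<dots> = C * (p - (\<phi> ^^ n) p)"
      using sum_lessThan_telescope'[of "\<lambda>i. (\<phi> ^^ i) p" n] by (simp add: sum_distrib_left[symmetric])
    also have "\<dots> \<le> C * (p - a)"
      using in_ap[of p n] \<open>a < p\<close> \<open>C \<ge> 0\<close> by (intro mult_left_mono) auto
    finally show "deriv (\<phi> ^^ n) u \<le> exp (C * (p - a)) * deriv (\<phi> ^^ n) v"
      by (simp add: deriv_eq exp_add[symmetric])
  qed
qed

text \<open>All difference quotients along \<open>X\<close> equal \<open>1\<close>.\<close>

lemma deriv_at_limit_of_fixed_points:
  assumes "(f has_field_derivative D) (at a)" and "f a = a"
    and "X \<longlonglongrightarrow> a" and "\<And>n. X n \<noteq> a" and "\<And>n. f (X n) = X n"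
  shows "D = (1::real)"
proof -
  have "((\<lambda>y. (f y - f a) / (y - a)) \<longlongrightarrow> D) (at a)"
    using assms(1) by (simp add: has_field_derivative_iff)
  moreover have "filterlim X (at a) sequentially"
    using assms(3,4) by (simp add: filterlim_at)
  ultimately have "(\<lambda>n. (f (X n) - f a) / (X n - a)) \<longlonglongrightarrow> D"
    by (rule filterlim_compose)
  then have "(\<lambda>n. 1) \<longlonglongrightarrow> D"
    using assms(2,4,5) by simp
  then show ?thesis by (simp add: LIMSEQ_const_iff)
qed

text \<open>Differentiating the relation between \<open>G\<close> and \<open>\<phi> ^^ n\<close>
  writes \<open>deriv G x\<close> as \<open>deriv G ((\<phi> ^^ n) x)\<close> times a ratio of
  derivatives of \<open>\<phi> ^^ n\<close>. Distortion bounds the ratio, and the other factor tends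
  to \<open>deriv G a = 1\<close>. The bound is independent of \<open>G\<close>, so it serves all
  powers of one map.\<close>

lemma commuting_uniformly_lipschitz:
  assumes \<phi>: "\<phi> \<in> carrier Diffeo_plus" and "\<phi> a = a" and "a < p"
    and less: "\<And>t. a < t \<Longrightarrow> t \<le> p \<Longrightarrow> \<phi> t < t"
  obtains K where "\<And>G u v. G \<in> carrier Diffeo_plus \<Longrightarrow> (\<And>x. G (\<phi> x) = \<phi> (G x)) \<Longrightarrow>
    G a = a \<Longrightarrow> G p = p \<Longrightarrow> u \<in> {\<phi> p..p} \<Longrightarrow> v \<in> {\<phi> p..p} \<Longrightarrow>
    \<bar>G u - G v\<bar> \<le> K * \<bar>u - v\<bar>"
proof -
  note D = Diffeo_plusD[OF \<phi>]
  obtain K where K: "\<And>n u v. u \<in> {\<phi> p..p} \<Longrightarrow> v \<in> {\<phi> p..p} \<Longrightarrow>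
      deriv (\<phi> ^^ n) u \<le> K * deriv (\<phi> ^^ n) v"
    using funpow_distortion[OF assms] by blast
  have "a < \<phi> p"
    using D(7)[of a p] \<open>a < p\<close> \<open>\<phi> a = a\<close> by simp
  have tendsto: "(\<lambda>n. (\<phi> ^^ n) x) \<longlonglongrightarrow> a" if "a \<le> x" "x \<le> p" for x
    using contraction_tendsto[OF D(6) strict_mono_mono[OF D(4)] \<open>\<phi> a = a\<close> less] that by blast
  show thesis
  proof
    fix G u v
    assume G: "G \<in> carrier Diffeo_plus" and comm: "\<And>x. G (\<phi> x) = \<phi> (G x)"
      and fix_a: "G a = a" and fix_p: "G p = p" and uv: "u \<in> {\<phi> p..p}" "v \<in> {\<phi> p..p}"
    note DG = Diffeo_plusD[OF G]
    have comm_n: "G ((\<phi> ^^ n) x) = (\<phi> ^^ n) (G x)" for n x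
      by (rule funpow_commute) (rule comm)
    \<comment> \<open>\<open>G\<close> fixes the whole orbit of \<open>p\<close>, which tends to
      \<open>a\<close> without reaching it.\<close>
    have "(\<phi> ^^ n) p \<noteq> a" for n
      using Diffeo_plusD(9)[OF Diffeo_plus_funpow[OF \<phi>], of n p a] \<open>a < p\<close>
        funpow_fixed[of \<phi> a n] \<open>\<phi> a = a\<close> by simp
    then have "deriv G a = 1"
      using \<open>a < p\<close>
      by (intro deriv_at_limit_of_fixed_points[OF smooth_has_derivative[OF DG(1)] fix_a tendsto[of p]])
         (auto simp: comm_n fix_p)
    have bound: "deriv G x \<le> K" if x: "x \<in> {\<phi> p..p}" for x
    proof -
      \<comment> \<open>\<open>G\<close> fixes both ends of the interval, so distortion may compare
        \<open>x\<close> with \<open>G x\<close>.\<close>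
      have Gx: "G x \<in> {\<phi> p..p}"
        using x DG(8)[of x p] DG(8)[of "\<phi> p" x] comm[of p] fix_p by simp
      have "deriv G x \<le> K * deriv G ((\<phi> ^^ n) x)" for n
      proof -
        note Dn = Diffeo_plusD[OF Diffeo_plus_funpow[OF \<phi>, of n]]
        have "((\<lambda>x. (\<phi> ^^ n) (G x)) has_field_derivative deriv (\<phi> ^^ n) (G x) * deriv G x) (at x)"
          by (rule DERIV_chain2[OF smooth_has_derivative[OF Dn(1)] smooth_has_derivative[OF DG(1)]])
        moreover have "((\<lambda>x. G ((\<phi> ^^ n) x)) has_field_derivative
            deriv G ((\<phi> ^^ n) x) * deriv (\<phi> ^^ n) x) (at x)"
          by (rule DERIV_chain2[OF smooth_has_derivative[OF DG(1)] smooth_has_derivative[OF Dn(1)]])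
        ultimately have eq: "deriv (\<phi> ^^ n) (G x) * deriv G x = deriv G ((\<phi> ^^ n) x) * deriv (\<phi> ^^ n) x"
          unfolding comm_n by (rule DERIV_unique)
        have "deriv (\<phi> ^^ n) (G x) * deriv G x \<le> deriv G ((\<phi> ^^ n) x) * (K * deriv (\<phi> ^^ n) (G x))"
          unfolding eq using DG(2)[of "(\<phi> ^^ n) x"] by (intro mult_left_mono K x Gx) simp
        then have "deriv (\<phi> ^^ n) (G x) * deriv G x \<le> deriv (\<phi> ^^ n) (G x) * (K * deriv G ((\<phi> ^^ n) x))"
          by (simp add: mult_ac)
        then show ?thesis
          using Dn(2)[of "G x"] by simp
      qed
      moreover have "(\<lambda>n. K * deriv G ((\<phi> ^^ n) x)) \<longlonglongrightarrow> K * deriv G a"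
        using x \<open>a < \<phi> p\<close>
        by (intro tendsto_mult tendsto_const isCont_tendsto_compose[OF smooth_isCont[OF smooth_deriv[OF DG(1)]]]
          tendsto) auto
      ultimately have "deriv G x \<le> K * deriv G a"
        by (intro LIMSEQ_le_const) auto
      then show ?thesis using \<open>deriv G a = 1\<close> by simp
    qed
    have "norm (deriv G x) \<le> K" if "x \<in> {\<phi> p..p}" for x
      using bound[OF that] DG(2)[of x] by simp
    then show "\<bar>G u - G v\<bar> \<le> K * \<bar>u - v\<bar>"
      using field_differentiable_bound[of "{\<phi> p..p}" G "deriv G" K u v] uv
        smooth_has_derivative[OF DG(1)] by (auto intro: has_field_derivative_at_within)
  qed
qed

text \<open>The points \<open>(g ^^ n) u\<close> converge to a fixed point \<open>l\<close>. The
  powers of \<open>k\<close>, the inverse of \<open>g\<close>, share one Lipschitz constant and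
  carry \<open>(g ^^ n) u\<close> and \<open>l\<close> back to \<open>u\<close> and
  \<open>l\<close>; so the distance from \<open>u\<close> to \<open>l\<close> is at most
  \<open>K\<close> times a null sequence.\<close>

lemma commuting_with_contraction_is_id:
  assumes \<phi>: "\<phi> \<in> carrier Diffeo_plus" and \<phi>_a: "\<phi> a = a" and "a < p"
    and less: "\<And>t. a < t \<Longrightarrow> t \<le> p \<Longrightarrow> \<phi> t < t"
    and g: "g \<in> carrier Diffeo_plus" and comm: "\<And>x. g (\<phi> x) = \<phi> (g x)"
    and "g a = a" and "g p = p" and u: "u \<in> {\<phi> p..p}"
  shows "g u = u"
proof -
  note Dg = Diffeo_plusD[OF g]
  define k where "k = inv_into UNIV g"
  have k: "k \<in> carrier Diffeo_plus"
    unfolding k_def by (rule Diffeo_plus_inv[OF g])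
  have gk: "g (k x) = x" "k (g x) = x" for x
    by (simp_all add: k_def Dg)
  have k_comm: "k (\<phi> x) = \<phi> (k x)" for x
    using comm[of "k x"] gk by metis
  obtain K where K: "\<And>G u v. G \<in> carrier Diffeo_plus \<Longrightarrow> (\<And>x. G (\<phi> x) = \<phi> (G x)) \<Longrightarrow>
      G a = a \<Longrightarrow> G p = p \<Longrightarrow> u \<in> {\<phi> p..p} \<Longrightarrow> v \<in> {\<phi> p..p} \<Longrightarrow> \<bar>G u - G v\<bar> \<le> K * \<bar>u - v\<bar>"
    using commuting_uniformly_lipschitz[OF \<phi> \<phi>_a \<open>a < p\<close> less] by blast
  have ends: "g (\<phi> p) = \<phi> p" "g p = p"
    using comm \<open>g p = p\<close> by simp_all
  obtain l where l: "(\<lambda>n. (g ^^ n) u) \<longlonglongrightarrow> l" "\<phi> p \<le> l" "l \<le> p" "g l = l"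
    using funpow_tendsto_fixed[OF Dg(6) strict_mono_mono[OF Dg(4)] ends] u by auto
  have kn: "(k ^^ n) ((g ^^ n) x) = x" for n x
  proof (induction n arbitrary: x)
    case (Suc n)
    then show ?case by (simp add: funpow_swap1 gk)
  qed simp
  have fixed_k: "k x = x" if "g x = x" for x
    using that gk by metis
  have "\<bar>u - l\<bar> \<le> K * \<bar>(g ^^ n) u - l\<bar>" for n
  proof -
    have "\<bar>(k ^^ n) ((g ^^ n) u) - (k ^^ n) l\<bar> \<le> K * \<bar>(g ^^ n) u - l\<bar>"
    proof (rule K)
      show "k ^^ n \<in> carrier Diffeo_plus" by (rule Diffeo_plus_funpow[OF k])
      show "(k ^^ n) (\<phi> x) = \<phi> ((k ^^ n) x)" for x
        by (rule funpow_commute[symmetric]) (simp add: k_comm)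
      show "(k ^^ n) a = a" "(k ^^ n) p = p"
        using \<open>g a = a\<close> \<open>g p = p\<close> by (simp_all add: funpow_fixed fixed_k)
      show "(g ^^ n) u \<in> {\<phi> p..p}"
        using u Diffeo_plusD(8)[OF Diffeo_plus_funpow[OF g], of n] ends funpow_fixed[of g _ n]
        by (metis atLeastAtMost_iff)
    qed (use l in simp)
    then show ?thesis
      by (simp add: kn funpow_fixed[of k l n, OF fixed_k[OF l(4)]])
  qed
  moreover have "(\<lambda>n. K * \<bar>(g ^^ n) u - l\<bar>) \<longlonglongrightarrow> K * \<bar>l - l\<bar>"
    by (intro tendsto_intros l)
  ultimately have "\<bar>u - l\<bar> \<le> K * \<bar>l - l\<bar>"
    by (intro LIMSEQ_le_const) auto
  with l show ?thesis by simp
qed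

subsection \<open>Reversers with a fixed point\<close>

lemma fixed_point_between:
  fixes f :: "real \<Rightarrow> real"
  assumes cont: "\<And>x. isCont f x" and "x < y"
    and "(f x > x \<and> f y < y) \<or> (f x < x \<and> f y > y)"
  obtains p where "x < p" "p < y" "f p = p"
proof -
  have "\<exists>p. x \<le> p \<and> p \<le> y \<and> f p - p = 0"
    using assms(3)
  proof
    assume "f x > x \<and> f y < y"
    then show ?thesis
      using \<open>x < y\<close> cont by (intro IVT2) auto
  next
    assume "f x < x \<and> f y > y"
    then show ?thesis
      using \<open>x < y\<close> cont by (intro IVT) auto
  qed
  then obtain p where "x \<le> p" "p \<le> y" "f p = p" by auto
  moreover from this assms(3) have "x \<noteq> p" "p \<noteq> y" by auto
  ultimately show thesis using that by force
qed

section \<open>Consequences of the reversing relation, cleared of inverses\<close>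

context
  fixes g h :: "real \<Rightarrow> real"
  assumes g: "g \<in> carrier Diffeo_plus" and h: "h \<in> carrier Diffeo_plus"
    and rev: "\<And>x. g (h (g x)) = h x"
begin

text \<open>Apply the increasing map \<open>g \<circ> h\<close> to \<open>x\<close> and
  \<open>g x\<close>, then use \<open>rev\<close>.\<close>

lemma reverser_swaps_sign:
  "x < g x \<Longrightarrow> g (h x) < h x" "g x < x \<Longrightarrow> h x < g (h x)"
proof -
  have "g (h x) < g (h (g x)) \<longleftrightarrow> x < g x" "g (h (g x)) < g (h x) \<longleftrightarrow> g x < x"
    by (simp_all add: Diffeo_plusD(7)[OF g] Diffeo_plusD(7)[OF h])
  then show "x < g x \<Longrightarrow> g (h x) < h x" "g x < x \<Longrightarrow> h x < g (h x)"
    by (simp_all add: rev)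
qed

text \<open>Otherwise \<open>g\<close> would move \<open>c\<close> and \<open>h c\<close>, the same
  point, in opposite directions.\<close>

lemma fixed_by_reverser: "h c = c \<Longrightarrow> g c = c"
  using reverser_swaps_sign[of c] by (cases "g c" c rule: linorder_cases) simp_all

text \<open>Conjugating by \<open>h\<close> twice inverts \<open>g\<close> twice.\<close>

lemma square_of_reverser_commutes: "g (h (h x)) = h (h (g x))"
  using rev[of "h (g x)"] rev[of x] by simp

text \<open>Allows \<open>h\<close> to be replaced by its inverse, which exchanges motion to the
  right and to the left.\<close>

lemma inv_is_reverser: "g (inv_into UNIV h (g x)) = inv_into UNIV h x"
proof -
  have "g (h (g (inv_into UNIV h (g x)))) = g x"
    using rev[of "inv_into UNIV h (g x)"] by (simp add: Diffeo_plusD(10)[OF h])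
  then have "h (g (inv_into UNIV h (g x))) = x"
    by (simp add: Diffeo_plusD(9)[OF g])
  then have "inv_into UNIV h (h (g (inv_into UNIV h (g x)))) = inv_into UNIV h x"
    by (rule arg_cong)
  then show ?thesis
    by (simp only: Diffeo_plusD(11)[OF h])
qed

text \<open>If \<open>g x \<noteq> x\<close>, then \<open>g\<close> moves \<open>x\<close> and \<open>h\<^sup>-\<^sup>1 x\<close> in opposite directions, so it fixes a
  point \<open>p\<close> between them. Kopell's lemma for \<open>\<phi> = h \<circ> h\<close> then applies because \<open>\<phi> p < x < p\<close>.\<close>

lemma fixed_in_basin:
  assumes "h a = a" "a < x" and less: "\<And>t. a < t \<Longrightarrow> t \<le> x \<Longrightarrow> h t < t"
  shows "g x = x"
proof (rule ccontr)
  assume ne: "g x \<noteq> x"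
  note Dg = Diffeo_plusD[OF g] and Dh = Diffeo_plusD[OF h]
  define y where "y = inv_into UNIV h x"
  have hy: "h y = x" by (simp add: y_def Dh)
  have "x < y"
    using Dh(7)[of x y] less[of x] \<open>a < x\<close> hy by simp
  have "(g x > x \<and> g y < y) \<or> (g x < x \<and> g y > y)"
  proof (cases "g y" y rule: linorder_cases)
    \<comment> \<open>A fixed point \<open>y\<close> of \<open>g\<close> would make
      \<open>h y = x\<close> fixed too.\<close>
    case equal
    then show ?thesis using ne rev[of y] hy by simp
  qed (use reverser_swaps_sign[of y] hy in simp_all)
  then obtain p where p: "x < p" "p < y" "g p = p"
    using fixed_point_between[OF Dg(6) \<open>x < y\<close>] by blast
  \<comment> \<open>Beyond \<open>x\<close> the hypothesis is silent, but \<open>t < y\<close> gives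
    \<open>h t < h y = x < t\<close>.\<close>
  have less': "h t < t" if "a < t" "t \<le> p" for t
    using less[of t] that Dh(7)[of t y] hy p by (cases "t \<le> x") auto
  have "g x = x"
  proof (rule commuting_with_contraction_is_id[OF Diffeo_plus_compose[OF h h]])
    show "(h \<circ> h) t < t" if "a < t" "t \<le> p" for t
      using less'[OF that] less'[of "h t"] that Dh(7)[of a t] \<open>h a = a\<close> by simp
    \<comment> \<open>As \<open>h y = x\<close>, this reads \<open>h (h p) < h x\<close>, and
      \<open>h x < x\<close>.\<close>
    have "h (h p) < h (h y)" using p Dh(7) by simp
    then show "x \<in> {(h \<circ> h) p..p}"
      using p hy less[of x] \<open>a < x\<close> by simp
    show "a < p" "(h \<circ> h) a = a" "g a = a" "g p = p"
      using p \<open>a < x\<close> \<open>h a = a\<close> fixed_by_reverser by simp_all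
    show "g ((h \<circ> h) t) = (h \<circ> h) (g t)" for t
      by (simp add: square_of_reverser_commutes)
  qed (rule g)
  with ne show False ..
qed

text \<open>Let \<open>a\<close> be the largest fixed point of \<open>h\<close> in
  \<open>[c, x]\<close>. As \<open>h\<close> moves \<open>x\<close> to the left, the intermediate
  value theorem forces it to move every point of \<open>(a, x]\<close> to the left, so
  \<open>x\<close> lies in the basin of \<open>a\<close>.\<close>

lemma fixed_right_of_contracting:
  assumes "h c = c" "c < x" "h x < x"
  shows "g x = x"
proof -
  note Dh = Diffeo_plusD[OF h]
  have "closed {t. h t = t}"
    using Dh(6) by (intro closed_Collect_eq continuous_at_imp_continuous_on) auto
  then have "compact ({c..x} \<inter> {t. h t = t})"
    by (intro compact_Int_closed) auto
  moreover have "c \<in> {c..x} \<inter> {t. h t = t}"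
    using assms by auto
  ultimately obtain a where a: "a \<in> {c..x} \<inter> {t. h t = t}"
      and max: "\<And>t. t \<in> {c..x} \<inter> {t. h t = t} \<Longrightarrow> t \<le> a"
    using compact_attains_sup[of "{c..x} \<inter> {t. h t = t}"] by blast
  show ?thesis
  proof (rule fixed_in_basin)
    show "h a = a" "a < x" using a assms by (auto simp: less_le)
    fix t assume t: "a < t" "t \<le> x"
    show "h t < t"
    proof (rule ccontr)
      assume "\<not> h t < t"
      moreover have "h t \<noteq> t" using max[of t] t a by auto
      ultimately have "t < h t" by simp
      moreover from this \<open>h x < x\<close> t have "t < x" by (cases "t = x") auto
      ultimately obtain p where "t < p" "p < x" "h p = p"
        using fixed_point_between[OF Dh(6), of t x] \<open>h x < x\<close> by blast
      then show False using max[of p] t a by auto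
    qed
  qed
qed

end

lemma fixed_right_of_reverser_fixed_point:
  assumes g: "g \<in> carrier Diffeo_plus" and h: "h \<in> carrier Diffeo_plus"
    and rev: "\<And>x. g (h (g x)) = h x" and c: "h c = c" "c < x"
  shows "g x = x"
proof -
  note Dh = Diffeo_plusD[OF h]
  consider "h x < x" | "h x = x" | "x < h x" by linarith
  then show ?thesis
  proof cases
    case 1
    with fixed_right_of_contracting[OF g h rev c] show ?thesis by blast
  next
    case 2
    with fixed_by_reverser[OF g h rev] show ?thesis by blast
  next
    case 3
    have "inv_into UNIV h c = c" using c Dh(11)[of c] by simp
    moreover have "inv_into UNIV h x < x"
      using 3 Dh(7)[of "inv_into UNIV h x" x] by (simp add: Dh(10))
    ultimately show ?thesis
      using fixed_right_of_contracting[OF g Diffeo_plus_inv[OF h] inv_is_reverser[OF g h rev]] c by blast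
  qed
qed

text \<open>Conjugation by \<open>x \<mapsto> - x\<close> carries results about the right of a fixed
  point over to the left.\<close>

lemma Diffeo_plus_reflect:
  assumes "f \<in> carrier Diffeo_plus"
  shows "(\<lambda>x. - f (- x)) \<in> carrier Diffeo_plus"
proof -
  note D = Diffeo_plusD[OF assms]
  have "((\<lambda>x. - f (- x)) has_field_derivative deriv f (- x)) (at x)" for x
    using DERIV_minus[OF DERIV_chain2[OF smooth_has_derivative[OF D(1), of "- x"] DERIV_minus[OF DERIV_ident]]]
    by simp
  then have "deriv (\<lambda>x. - f (- x)) x = deriv f (- x)" for x
    by (rule DERIV_imp_deriv)
  moreover have "smooth (\<lambda>x. - f (- x))"
    using smooth_compose[OF smooth_affine[of "-1" 0] smooth_compose[OF D(1) smooth_affine[of "-1" 0]]]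
    by simp
  moreover have "surj (\<lambda>x. - f (- x))"
    by (rule surjI[of _ "\<lambda>y. - inv_into UNIV f (- y)"]) (simp add: D)
  ultimately show ?thesis
    using D(2) by (simp add: carrier_Diffeo_plus_iff)
qed

lemma reverser_with_fixed_point_imp_id:
  assumes g: "g \<in> carrier Diffeo_plus" and h: "h \<in> carrier Diffeo_plus"
    and rev: "\<And>x. g (h (g x)) = h x" and c: "h c = c"
  shows "g x = x"
proof -
  consider "c < x" | "x = c" | "x < c" by linarith
  then show ?thesis
  proof cases
    case 1
    with fixed_right_of_reverser_fixed_point[OF g h rev c] show ?thesis by blast
  next
    case 2
    with fixed_by_reverser[OF g h rev c] show ?thesis by simp
  next
    case 3
    \<comment> \<open>The reflected maps satisfy the same relation, and \<open>x < c\<close> becomes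
      \<open>- c < - x\<close>.\<close>
    have "- g (- (- x)) = - x"
      by (rule fixed_right_of_reverser_fixed_point[OF Diffeo_plus_reflect[OF g] Diffeo_plus_reflect[OF h],
          where c = "- c"]) (use 3 c rev in auto)
    then show ?thesis by simp
  qed
qed

subsection \<open>Abel's equation\<close>

text \<open>A bounded orbit would increase to a fixed point, which \<open>gt\<close>
  excludes.\<close>

lemma funpow_eventually_ge:
  fixes f :: "real \<Rightarrow> real"
  assumes cont: "\<And>x. isCont f x" and gt: "\<And>x. f x > x"
  shows "\<exists>N. \<forall>n\<ge>N. (f ^^ n) x \<ge> B"
proof -
  have inc: "incseq (\<lambda>n. (f ^^ n) x)"
    using gt by (intro incseq_SucI) (simp add: less_imp_le)
  have "\<exists>N. (f ^^ N) x \<ge> B"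
  proof (rule ccontr)
    assume "\<nexists>N. (f ^^ N) x \<ge> B"
    then obtain l where "(\<lambda>n. (f ^^ n) x) \<longlonglongrightarrow> l"
      using incseq_convergent[OF inc, of B] by (meson linorder_le_cases)
    then have "f l = l" by (rule funpow_limit_fixed[OF cont])
    with gt[of l] show False by simp
  qed
  then show ?thesis
    using inc by (meson incseqD order_trans)
qed

text \<open>Abel's equation. For a smooth step \<open>R\<close> that increases on an interval containing the
  fundamental domain \<open>[0, h 0]\<close>, the formal series \<open>\<Sum>n\<in>\<int>. R \<circ> h\<^sup>n\<close> satisfies it up to a divergent
  constant; subtracting \<open>1\<close> from the terms with \<open>n \<ge> 0\<close> makes the series locally finite.\<close>

lemma abel_equation:
  assumes h: "h \<in> carrier Diffeo_plus" and gt: "\<And>x. h x > x"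
  obtains H where "H \<in> carrier Diffeo_plus" "\<And>x. H (h x) = H x + 1"
proof -
  note Dh = Diffeo_plusD[OF h]
  define k where "k = inv_into UNIV h"
  have k: "k \<in> carrier Diffeo_plus" unfolding k_def by (rule Diffeo_plus_inv[OF h])
  have hk: "h (k x) = x" "k (h x) = x" for x by (simp_all add: k_def Dh)
  have hkn: "(h ^^ n) ((k ^^ n) x) = x" for n x
    by (induction n arbitrary: x) (simp_all add: funpow_swap1 hk)
  note Dhn = Diffeo_plusD[OF Diffeo_plus_funpow[OF h]] and Dkn = Diffeo_plusD[OF Diffeo_plus_funpow[OF k]]
  \<comment> \<open>The margin of \<open>1\<close> on each side keeps \<open>deriv R\<close>
    positive on the whole fundamental domain, ends included.\<close>
  obtain R where R: "smooth R" "\<And>x. x \<le> -1 \<Longrightarrow> R x = 0" "\<And>x. x \<ge> h 0 + 1 \<Longrightarrow> R x = 1"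
      "\<And>x. deriv R x \<ge> 0" "\<And>x. -1 < x \<Longrightarrow> x < h 0 + 1 \<Longrightarrow> deriv R x > 0"
    using smooth_step_exists[of "-1" "h 0 + 1"] gt[of 0] by auto
  \<comment> \<open>The terms of indices \<open>n\<close> and \<open>- (n + 1)\<close> are paired,
    so each integer occurs once.\<close>
  define c where "c n x = R ((h ^^ n) x) - 1 + R ((k ^^ Suc n) x)" for n x
  define c' where "c' n x = deriv R ((h ^^ n) x) * deriv (h ^^ n) x
    + deriv R ((k ^^ Suc n) x) * deriv (k ^^ Suc n) x" for n x
  define H where "H x = (\<Sum>n. c n x)" for x
  have stable: "\<exists>N. \<forall>n\<ge>N. \<forall>x\<in>{\<alpha>..\<beta>}. R ((h ^^ n) x) = 1 \<and> R ((k ^^ n) x) = 0" for \<alpha> \<beta>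
  proof -
    obtain M N where M: "\<forall>n\<ge>M. (h ^^ n) \<alpha> \<ge> h 0 + 1" and N: "\<forall>n\<ge>N. (h ^^ n) (-1) \<ge> \<beta>"
      using funpow_eventually_ge[OF Dh(6) gt] by metis
    have "R ((h ^^ n) x) = 1 \<and> R ((k ^^ n) x) = 0" if n: "n \<ge> max M N" and x: "x \<in> {\<alpha>..\<beta>}" for n x
    proof
      have "(h ^^ n) \<alpha> \<le> (h ^^ n) x" using x Dhn(8) by simp
      with M n show "R ((h ^^ n) x) = 1" by (intro R(3)) (meson max.boundedE order_trans)
      \<comment> \<open>That \<open>(k ^^ n) x\<close> lies below \<open>-1\<close> is tested after
        applying \<open>h ^^ n\<close>.\<close>
      have "(h ^^ n) ((k ^^ n) x) \<le> (h ^^ n) (-1)" using N n x by (simp add: hkn) (meson order_trans)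
      then show "R ((k ^^ n) x) = 0" by (intro R(2)) (simp add: Dhn(8))
    qed
    then show ?thesis by blast
  qed
  \<comment> \<open>The values of \<open>R\<close> at index \<open>m\<close> are kept because they
    are the boundary terms of the telescoping sum in \<open>abel\<close>.\<close>
  have H_eq_sum: "\<exists>N. \<forall>m\<ge>N. \<forall>x\<in>{\<alpha>..\<beta>}. H x = (\<Sum>n<m. c n x)
      \<and> R ((h ^^ m) x) = 1 \<and> R ((k ^^ m) x) = 0" for \<alpha> \<beta>
  proof -
    obtain N where N: "\<forall>n\<ge>N. \<forall>x\<in>{\<alpha>..\<beta>}. R ((h ^^ n) x) = 1 \<and> R ((k ^^ n) x) = 0"
      using stable by blast
    have "H x = (\<Sum>n<m. c n x)" if "m \<ge> N" "x \<in> {\<alpha>..\<beta>}" for m x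
      unfolding H_def
    proof (rule suminf_finite)
      fix n assume "n \<notin> {..<m}"
      then have "R ((h ^^ n) x) = 1" "R ((k ^^ Suc n) x) = 0"
        using N that by (meson le_SucI lessThan_iff not_le order_trans)+
      then show "c n x = 0" by (simp add: c_def)
    qed simp
    with N show ?thesis by blast
  qed
  have c_deriv: "(c n has_field_derivative c' n x) (at x)" for n x
    unfolding c_def[abs_def] c'_def
    using DERIV_add[OF DERIV_diff[OF DERIV_chain2[OF smooth_has_derivative[OF R(1)]
        smooth_has_derivative[OF Dhn(1)[of n], of x]] DERIV_const[of 1]]
      DERIV_chain2[OF smooth_has_derivative[OF R(1)] smooth_has_derivative[OF Dkn(1)[of "Suc n"], of x]]]
    by simp
  have c_smooth: "smooth (c n)" for n
    using smooth_add[OF smooth_add[OF smooth_compose[OF R(1) Dhn(1)[of n]] smooth_const[of "-1"]]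
      smooth_compose[OF R(1) Dkn(1)[of "Suc n"]]] by (simp add: c_def[abs_def])
  have near: "\<exists>N. \<forall>m\<ge>N. \<forall>\<^sub>F y in nhds x. H y = (\<Sum>n<m. c n y)" for x
  proof -
    obtain N where N: "\<forall>m\<ge>N. \<forall>y\<in>{x - 1..x + 1}. H y = (\<Sum>n<m. c n y)"
      using H_eq_sum by blast
    have "\<forall>\<^sub>F y in nhds x. y \<in> {x - 1<..<x + 1}"
      by (rule eventually_nhds_in_open) auto
    then have "\<forall>\<^sub>F y in nhds x. H y = (\<Sum>n<m. c n y)" if "m \<ge> N" for m
      by (rule eventually_mono) (use N that in auto)
    then show ?thesis by blast
  qed
  have H_smooth: "smooth H"
  proof (rule smooth_local)
    fix x
    obtain N where "\<forall>\<^sub>F y in nhds x. H y = (\<Sum>n<N. c n y)"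
      using near by blast
    then show "\<exists>f. smooth f \<and> (\<forall>\<^sub>F y in nhds x. H y = f y)"
      by (intro exI[of _ "\<lambda>y. \<Sum>n<N. c n y"] conjI smooth_sum c_smooth)
  qed
  have c'_nonneg: "c' n x \<ge> 0" for n x
    unfolding c'_def
    by (intro add_nonneg_nonneg mult_nonneg_nonneg R(4) less_imp_le[OF Dhn(2)] less_imp_le[OF Dkn(2)])
  \<comment> \<open>Every orbit meets the fundamental domain, where \<open>deriv R\<close> is
    positive: forwards if \<open>x < h 0\<close>, backwards otherwise.\<close>
  have c'_pos: "\<exists>n. c' n x > 0" for x
  proof (cases "x < h 0")
    case True
    \<comment> \<open>Minimality gives \<open>(h ^^ n) x < h 0\<close>, as the preceding iterate is
      negative.\<close>
    define n where "n = (LEAST n. (h ^^ n) x \<ge> 0)"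
    have "\<exists>n. (h ^^ n) x \<ge> 0" using funpow_eventually_ge[OF Dh(6) gt] by blast
    then have ge: "(h ^^ n) x \<ge> 0" unfolding n_def by (rule LeastI_ex)
    have lt: "(h ^^ n) x < h 0"
    proof (cases n)
      case (Suc m)
      then have "m < n" by simp
      then have "\<not> (h ^^ m) x \<ge> 0" unfolding n_def by (rule not_less_Least)
      with Suc show ?thesis using Dh(7) by simp
    qed (use True in simp)
    have "deriv R ((h ^^ n) x) * deriv (h ^^ n) x > 0"
      using ge lt R(5) Dhn(2) by simp
    moreover have "deriv R ((k ^^ Suc n) x) * deriv (k ^^ Suc n) x \<ge> 0"
      by (intro mult_nonneg_nonneg R(4) less_imp_le[OF Dkn(2)])
    ultimately show ?thesis by (auto simp: c'_def intro!: exI[of _ n])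
  next
    case False
    \<comment> \<open>Here \<open>m\<close> is positive, which matches the exponent
      \<open>Suc n\<close> of \<open>k\<close> in \<open>c' n\<close>.\<close>
    define m where "m = (LEAST m. (k ^^ m) x < h 0)"
    obtain N where "(h ^^ N) 0 \<ge> x" using funpow_eventually_ge[OF Dh(6) gt] by blast
    then have "(h ^^ N) ((k ^^ N) x) \<le> (h ^^ N) 0" by (simp add: hkn)
    then have "(k ^^ N) x < h 0" using gt[of 0] Dhn(8) by force
    then have lt: "(k ^^ m) x < h 0" unfolding m_def by (rule LeastI)
    with False obtain n where m: "m = Suc n" by (cases m) auto
    then have "n < m" by simp
    then have "\<not> (k ^^ n) x < h 0" unfolding m_def by (rule not_less_Least)
    then have "h (k ((k ^^ n) x)) \<ge> h 0" by (simp add: hk)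
    then have ge: "(k ^^ Suc n) x \<ge> 0" by (simp add: Dh(8))
    have "deriv R ((k ^^ Suc n) x) * deriv (k ^^ Suc n) x > 0"
      using ge lt unfolding m by (intro mult_pos_pos R(5) Dkn(2)) simp_all
    moreover have "deriv R ((h ^^ n) x) * deriv (h ^^ n) x \<ge> 0"
      by (intro mult_nonneg_nonneg R(4) less_imp_le[OF Dhn(2)])
    ultimately show ?thesis by (auto simp: c'_def intro!: exI[of _ n])
  qed
  have H_deriv: "deriv H x > 0" for x
  proof -
    obtain N where N: "\<forall>m\<ge>N. \<forall>\<^sub>F y in nhds x. H y = (\<Sum>n<m. c n y)"
      using near by blast
    obtain i where i: "c' i x > 0" using c'_pos by blast
    define m where "m = max N (Suc i)"
    have "((\<lambda>y. \<Sum>n<m. c n y) has_field_derivative (\<Sum>n<m. c' n x)) (at x)"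
      by (rule DERIV_sum) (rule c_deriv)
    then have "(H has_field_derivative (\<Sum>n<m. c' n x)) (at x)"
      using DERIV_cong_ev[OF refl _ refl] N by (metis m_def max.cobounded1)
    moreover have "(\<Sum>n<m. c' n x) > 0"
      using i c'_nonneg by (intro sum_pos2[of _ i]) (auto simp: m_def)
    ultimately show ?thesis by (simp add: DERIV_imp_deriv)
  qed
  have abel: "H (h x) = H x + 1" for x
  proof -
    obtain N where N: "\<forall>m\<ge>N. \<forall>y\<in>{x..h x}. H y = (\<Sum>n<m. c n y)
        \<and> R ((h ^^ m) y) = 1 \<and> R ((k ^^ m) y) = 0"
      using H_eq_sum by blast
    \<comment> \<open>Replacing \<open>x\<close> by \<open>h x\<close> shifts the indices by one, so
      only the outermost terms survive; for large \<open>m\<close> they are \<open>1\<close> and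
      \<open>0\<close>.\<close>
    have "(\<Sum>n<m. c n (h x)) - (\<Sum>n<m. c n x) = R ((h ^^ m) x) - R ((k ^^ m) x)" for m
    proof (induction m)
      case (Suc m)
      have "c m (h x) = R ((h ^^ Suc m) x) - 1 + R ((k ^^ m) x)"
        by (simp add: c_def funpow_swap1 hk)
      with Suc show ?case by (simp add: c_def)
    qed simp
    from this[of N] show ?thesis
      using N[rule_format, OF order_refl, of x] N[rule_format, OF order_refl, of "h x"] gt[of x] by simp
  qed
  \<comment> \<open>Iterates of \<open>h\<close> and \<open>k\<close> change \<open>H\<close> by any
    integer, and the intermediate value theorem fills the gaps.\<close>
  have "surj H"
    unfolding surj_def
  proof
    fix y
    obtain n where n: "real n \<ge> \<bar>y - H 0\<bar>" using real_arch_simple by blast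
    have up: "H ((h ^^ n) x) = H x + real n" for x n by (induction n) (simp_all add: abel)
    have "(h ^^ n) 0 \<ge> 0"
    proof (induction n)
      case (Suc n)
      then show ?case using gt[of "(h ^^ n) 0"] by simp
    qed simp
    moreover have "(k ^^ n) 0 \<le> 0"
    proof (induction n)
      case (Suc n)
      then show ?case using gt[of "k ((k ^^ n) 0)"] by (simp add: hk)
    qed simp
    moreover have "H ((k ^^ n) 0) = H 0 - real n"
      using up[of n "(k ^^ n) 0"] by (simp add: hkn)
    ultimately have "\<exists>x\<ge>(k ^^ n) 0. x \<le> (h ^^ n) 0 \<and> H x = y"
      using n up[of n 0] by (intro IVT') (auto intro: continuous_at_imp_continuous_on smooth_isCont[OF H_smooth])
    then show "\<exists>x. y = H x" by blast
  qed
  with H_smooth H_deriv have "H \<in> carrier Diffeo_plus"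
    by (simp add: carrier_Diffeo_plus_iff)
  then show thesis using abel by (rule that)
qed

subsection \<open>Reversible diffeomorphisms\<close>

lemma reversible_Diffeo_plus_iff:
  assumes g: "g \<in> carrier Diffeo_plus"
  shows "reversible_in Diffeo_plus g \<longleftrightarrow> (\<exists>h \<in> carrier Diffeo_plus. \<forall>x. g (h (g x)) = h x)"
  unfolding reversible_in_def
proof (intro bex_cong refl)
  fix h assume h: "h \<in> carrier Diffeo_plus"
  note Dg = Diffeo_plusD[OF g] and Dh = Diffeo_plusD[OF h]
  have "h \<otimes>\<^bsub>Diffeo_plus\<^esub> g \<otimes>\<^bsub>Diffeo_plus\<^esub> inv\<^bsub>Diffeo_plus\<^esub> h = inv\<^bsub>Diffeo_plus\<^esub> g
      \<longleftrightarrow> (\<forall>y. h (g (inv_into UNIV h y)) = inv_into UNIV g y)"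
    by (simp add: mult_Diffeo_plus m_inv_Diffeo_plus g h fun_eq_iff)
  also have "\<dots> \<longleftrightarrow> (\<forall>y. g (h (g (inv_into UNIV h y))) = y)"
    using Dg(10,11) by metis
  also have "\<dots> \<longleftrightarrow> (\<forall>x. g (h (g x)) = h x)"
    using Dh(10,11) by metis
  finally show "h \<otimes>\<^bsub>Diffeo_plus\<^esub> g \<otimes>\<^bsub>Diffeo_plus\<^esub> inv\<^bsub>Diffeo_plus\<^esub> h = inv\<^bsub>Diffeo_plus\<^esub> g
      \<longleftrightarrow> (\<forall>x. g (h (g x)) = h x)" .
qed

lemma conjugate_Diffeo_plus_iff:
  "conjugate_in Diffeo_plus g f \<longleftrightarrow> (\<exists>K \<in> carrier Diffeo_plus. \<forall>x. K (g x) = f (K x))"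
  unfolding conjugate_in_def
proof (intro bex_cong refl)
  fix K assume K: "K \<in> carrier Diffeo_plus"
  have "K \<otimes>\<^bsub>Diffeo_plus\<^esub> g \<otimes>\<^bsub>Diffeo_plus\<^esub> inv\<^bsub>Diffeo_plus\<^esub> K = f
      \<longleftrightarrow> (\<forall>y. K (g (inv_into UNIV K y)) = f y)"
    by (simp add: mult_Diffeo_plus m_inv_Diffeo_plus K fun_eq_iff)
  also have "\<dots> \<longleftrightarrow> (\<forall>x. K (g x) = f (K x))"
    using Diffeo_plusD(10,11)[OF K] by metis
  finally show "K \<otimes>\<^bsub>Diffeo_plus\<^esub> g \<otimes>\<^bsub>Diffeo_plus\<^esub> inv\<^bsub>Diffeo_plus\<^esub> K = f
      \<longleftrightarrow> (\<forall>x. K (g x) = f (K x))" .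
qed

text \<open>As \<open>g\<close> is not the identity, \<open>h\<close> has no fixed point and moves
  all points in one direction; if that is to the left, its inverse is taken.\<close>

lemma increasing_reverser_exists:
  assumes g: "g \<in> carrier Diffeo_plus" and h: "h \<in> carrier Diffeo_plus"
    and rev: "\<And>x. g (h (g x)) = h x" and "g x0 \<noteq> x0"
  obtains k where "k \<in> carrier Diffeo_plus" "\<And>x. g (k (g x)) = k x" "\<And>x. k x > x"
proof -
  note Dh = Diffeo_plusD[OF h]
  have no_fix: "h x \<noteq> x" for x
    using reverser_with_fixed_point_imp_id[OF g h rev] \<open>g x0 \<noteq> x0\<close> by blast
  show thesis
  proof (cases "\<forall>x. h x > x")
    case True
    then show ?thesis using that[of h] h rev by blast
  next
    case False
    then obtain x1 where x1: "h x1 < x1" using no_fix by (meson linorder_neqE)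
    have less: "h x < x" for x
    proof (rule ccontr)
      assume "\<not> h x < x"
      then have x: "x < h x" using no_fix[of x] by simp
      with x1 have "x \<noteq> x1" by auto
      then obtain p where "h p = p"
        using fixed_point_between[OF Dh(6), of x x1] fixed_point_between[OF Dh(6), of x1 x] x x1
        by (meson linorder_neqE)
      with no_fix show False by blast
    qed
    have "x < inv_into UNIV h x" for x
      using less[of "inv_into UNIV h x"] by (simp add: Dh(10))
    then show ?thesis
      using that[of "inv_into UNIV h"] Diffeo_plus_inv[OF h] inv_is_reverser[OF g h rev] by blast
  qed
qed

text \<open>If \<open>g\<close> moves \<open>0\<close>, it moves \<open>h 0 > 0\<close> in the
  opposite direction.\<close>

lemma reversed_has_fixed_point:
  assumes g: "g \<in> carrier Diffeo_plus" and h: "h \<in> carrier Diffeo_plus"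
    and rev: "\<And>x. g (h (g x)) = h x" and gt: "\<And>x. h x > x"
  obtains q where "g q = q"
proof (cases "g 0" "0 :: real" rule: linorder_cases)
  case less
  with fixed_point_between[OF Diffeo_plusD(6)[OF g] gt[of 0]] reverser_swaps_sign(2)[OF g h rev, of 0]
  show thesis using that by blast
next
  case greater
  with fixed_point_between[OF Diffeo_plusD(6)[OF g] gt[of 0]] reverser_swaps_sign(1)[OF g h rev, of 0]
  show thesis using that by blast
qed (rule that)

text \<open>By \<open>shift\<close>, \<open>f\<close> fixes \<open>x + 1\<close> exactly when its
  inverse fixes \<open>x\<close>, so fixedness spreads from \<open>0\<close> both ways.\<close>

lemma fixes_integers:
  assumes f: "f \<in> carrier Diffeo_plus" and "f 0 = 0"
    and shift: "\<And>x. f (x + 1) = inv_into UNIV f x + 1"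
  shows "f (of_int n) = of_int n"
proof (induction n rule: int_induct[where k = 0])
  case (step1 i)
  then have "inv_into UNIV f (of_int i) = of_int i"
    using Diffeo_plusD(11)[OF f] by metis
  with shift[of "of_int i"] show ?case by simp
next
  case (step2 i)
  then have "inv_into UNIV f (of_int (i - 1)) = of_int (i - 1)"
    using shift[of "of_int (i - 1)"] by simp
  then show ?case
    using Diffeo_plusD(10)[OF f] by metis
qed (use \<open>f 0 = 0\<close> in simp)

lemma reversible_imp_conjugate_to_normal_form:
  assumes g: "g \<in> carrier Diffeo_plus" and h: "h \<in> carrier Diffeo_plus"
    and rev: "\<And>x. g (h (g x)) = h x"
  obtains f K where "f \<in> carrier Diffeo_plus" "K \<in> carrier Diffeo_plus"
    "\<And>x. K (g x) = f (K x)" "f 0 = 0" "\<And>x. f (x + 1) = inv_into UNIV f x + 1"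
proof (cases "\<forall>x. g x = x")
  case True
  \<comment> \<open>The identity is already in normal form.\<close>
  then show ?thesis
    using that[of id id] Diffeo_plus_id by simp
next
  case False
  then obtain k where k: "k \<in> carrier Diffeo_plus" and krev: "\<And>x. g (k (g x)) = k x"
      and gt: "\<And>x. k x > x"
    using increasing_reverser_exists[OF g h rev] by blast
  obtain q where q: "g q = q"
    using reversed_has_fixed_point[OF g k krev gt] by blast
  obtain H where H: "H \<in> carrier Diffeo_plus" and abel: "\<And>x. H (k x) = H x + 1"
    using abel_equation[OF k gt] by blast
  \<comment> \<open>Subtracting \<open>H q\<close> sends \<open>q\<close> to \<open>0\<close>,
    whence \<open>f 0 = 0\<close>, and preserves Abel's equation.\<close>
  define K where "K x = H x - H q" for x
  have K: "K \<in> carrier Diffeo_plus"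
    using Diffeo_plus_compose[OF Diffeo_plus_affine[of 1 "- H q"] H] by (simp add: K_def[abs_def] comp_def)
  have Kk: "K (k x) = K x + 1" for x
    by (simp add: K_def abel)
  define f where "f = K \<circ> g \<circ> inv_into UNIV K"
  have f: "f \<in> carrier Diffeo_plus"
    unfolding f_def by (intro Diffeo_plus_compose K g Diffeo_plus_inv)
  have fK: "f (K x) = K (g x)" for x
    by (simp add: f_def Diffeo_plusD(11)[OF K])
  \<comment> \<open>This is \<open>krev\<close> transported by \<open>K\<close>, which turns
    \<open>k\<close> into the translation by \<open>1\<close>.\<close>
  have "f (f z + 1) = z + 1" for z
  proof -
    obtain y where z: "z = K y" using Diffeo_plusD(10)[OF K] by metis
    have "f (f z + 1) = f (K (k (g y)))" by (simp add: z fK Kk)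
    also have "\<dots> = K (k y)" by (simp add: fK krev)
    finally show ?thesis by (simp add: z Kk)
  qed
  \<comment> \<open>Put \<open>z = inv_into UNIV f x\<close>.\<close>
  then have "f (x + 1) = inv_into UNIV f x + 1" for x
    using Diffeo_plusD(10)[OF f] by metis
  moreover have "f 0 = 0"
    using fK[of q] q by (simp add: K_def)
  ultimately show thesis
    using that[OF f K] fK by simp
qed

theorem theorem1p1:
  fixes g :: "real \<Rightarrow> real"
  assumes "g \<in> carrier Diffeo_plus"
  shows "reversible_in Diffeo_plus g \<longleftrightarrow>
    (\<exists>f \<in> carrier Diffeo_plus. conjugate_in Diffeo_plus g f \<and>
      (\<forall>n :: int. f (of_int n) = of_int n) \<and>
      (\<forall>x :: real. f (x + 1) = inv_into UNIV f x + 1))"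
    (is "_ \<longleftrightarrow> ?R")
proof
  assume "reversible_in Diffeo_plus g"
  then obtain h where h: "h \<in> carrier Diffeo_plus" "\<And>x. g (h (g x)) = h x"
    using reversible_Diffeo_plus_iff[OF assms] by blast
  then obtain f K where fK: "f \<in> carrier Diffeo_plus" "K \<in> carrier Diffeo_plus"
      "\<And>x. K (g x) = f (K x)" "f 0 = 0" "\<And>x. f (x + 1) = inv_into UNIV f x + 1"
    using reversible_imp_conjugate_to_normal_form[OF assms] by blast
  then show ?R
    using fixes_integers[OF fK(1,4,5)] conjugate_Diffeo_plus_iff by blast
next
  assume ?R
  then obtain f K where f: "f \<in> carrier Diffeo_plus" and K: "K \<in> carrier Diffeo_plus"
      and conj: "\<And>x. K (g x) = f (K x)" and shift: "\<And>x. f (x + 1) = inv_into UNIV f x + 1"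
    unfolding conjugate_Diffeo_plus_iff by blast
  \<comment> \<open>The translation by \<open>-1\<close>, pulled back by \<open>K\<close>.\<close>
  define h where "h x = inv_into UNIV K (K x - 1)" for x
  have Kh: "K (h x) = K x - 1" for x
    by (simp add: h_def Diffeo_plusD(10)[OF K])
  \<comment> \<open>The translation by \<open>-1\<close> reverses \<open>f\<close>: apply
    \<open>f\<close> to \<open>shift\<close> at \<open>x - 1\<close>, rearranged.\<close>
  have ffx: "f (f x - 1) = x - 1" for x
  proof -
    have "f x - 1 = inv_into UNIV f (x - 1)" using shift[of "x - 1"] by simp
    then show ?thesis by (simp add: Diffeo_plusD(10)[OF f])
  qed
  have "h = inv_into UNIV K \<circ> ((\<lambda>x. 1 * x + - 1) \<circ> K)"
    by (simp add: h_def fun_eq_iff)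
  then have "h \<in> carrier Diffeo_plus"
    using Diffeo_plus_compose[OF Diffeo_plus_inv[OF K] Diffeo_plus_compose[OF Diffeo_plus_affine[of 1 "- 1"] K]]
    by simp
  moreover have "K (g (h (g x))) = K (h x)" for x
    by (simp add: conj Kh ffx)
  then have "g (h (g x)) = h x" for x
    by (simp add: Diffeo_plusD(9)[OF K])
  ultimately show "reversible_in Diffeo_plus g"
    using reversible_Diffeo_plus_iff[OF assms] by blast
qed

end
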